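(* Let $K$ be a $d$-dimensional simplicial complex and $(F,R)$ a rooted forest of $K$. Then $(F,R)$ corresponds to a gradient if and only if $F$ simplicially collapses to $R$.
   Context: A simplicial complex $K$ is a finite family of finite sets closed under subsets; $K_p$ is the set of $p$-cells (elements of size $p+1$), $K_{\le p}$ the $p$-skeleton; $K$ is $d$-dimensional if its maximal cells have dimension at most $d$. The incidence matrix $\partial_d$ has rows indexed by $K_{d-1}$, columns by $K_d$, entry $(-1)^j$ at $(r,f)$ if $f=\{v_0<\dots<v_d\}$, $r=f\setminus\{v_j\}$, and $0$ otherwise. For $F\subseteq K_d$ and $R\subseteq K_{d-1}$ with $\bar R=K_{d-1}\setminus R$, $(F,R)$ is a rooted forest of $K$ if the columns of $\partial_d$ indexed by $F$ are independent and the rows indexed by $\bar R$ of the submatrix with columns $F$ form a basis of its row space (equivalently $|\bar R|=|F|$ and the square submatrix with rows $\bar R$, columns $F$ is nonsingular). "$F$ simplicially collapses to $R$" means the subcomplex $K_{\le d-1}\cup F$ can be reduced to $K_{\le d-2}\cup R$ by a finite sequence of elementary collapses, each removing a pair $\sigma<\tau$ where $\tau$ is a $d$-cell, $\sigma$ a $(d-1)$-face of $\tau$, and $\sigma$ is a face of no other cell of the current complex. A discrete Morse function is $f:K\to\mathbb{R}$ such that each $p$-cell $\sigma$ has at most one $(p-1)$-face $\tau$ with $f(\tau)\ge f(\sigma)$ and at most one $(p+1)$-coface $\tau$ with $f(\tau)\le f(\sigma)$; $\sigma$ is critical if there are none; $c_p(f)$ counts critical $p$-cells. The gradient is $V_f=\{(\sigma,\tau):\sigma\text{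 a codimension-one face of }\tau,\ f(\tau)\le f(\sigma)\}$; $\mathcal{M}(K)$ is the set of discrete Morse functions modulo $V_f=V_g$; $\mathcal{M}_\ell(K)=\{f: c_d(f)=\ell,\ c_p(f)=|K_p|\ \forall p<d-1\}$. $(F,R)$ corresponds to a gradient if there exist $\ell$ and $f\in\mathcal{M}_\ell(K)$ such that $F$ is the set of non-critical $d$-cells of $f$ and $R$ the set of critical $(d-1)$-cells of $f$. *)

theory Defs
  imports Complex_Main "HOL-Library.Function_Algebras"
begin

section \<open>Simplicial complexes\<close>

definition fin_complex :: "'a set set \<Rightarrow> bool" where
  "fin_complex K \<longleftrightarrow>
     finite K \<and> (\<forall>\<sigma>\<in>K. finite \<sigma>) \<and> (\<forall>\<sigma>\<in>K. \<forall>\<tau>. \<tau> \<subseteq> \<sigma> \<longrightarrow> \<tau> \<in> K)"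

text \<open>Dimensions are integers: the empty set, which belongs to every nonempty complex,
  is the unique cell of dimension \<open>-1\<close>.\<close>

definition cell_dim :: "'a set \<Rightarrow> int" where
  "cell_dim \<sigma> = int (card \<sigma>) - 1"

definition cells :: "'a set set \<Rightarrow> int \<Rightarrow> 'a set set" where
  "cells K p = {\<sigma> \<in> K. cell_dim \<sigma> = p}"

definition skeleton :: "'a set set \<Rightarrow> int \<Rightarrow> 'a set set" where
  "skeleton K p = {\<sigma> \<in> K. cell_dim \<sigma> \<le> p}"

definition has_dimension :: "'a set set \<Rightarrow> nat \<Rightarrow> bool" where
  "has_dimension K d \<longleftrightarrow>
     (\<forall>\<sigma>\<in>K. (\<forall>\<tau>\<in>K. \<sigma> \<subseteq> \<tau> \<longrightarrow> \<tau> = \<sigma>) \<longrightarrow> cell_dim \<sigma> \<le> int d)"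

definition codim1_face :: "'a set \<Rightarrow> 'a set \<Rightarrow> bool" where
  "codim1_face \<sigma> \<tau> \<longleftrightarrow> \<sigma> \<subset> \<tau> \<and> cell_dim \<tau> = cell_dim \<sigma> + 1"


section \<open>Rooted forests\<close>

text \<open>The row index comes first. The matrix is extended by \<open>0\<close> outside its index sets, so that
  its columns are functions supported on the \<open>(d-1)\<close>-cells.\<close>

definition incidence_matrix :: "'a::linorder set set \<Rightarrow> nat \<Rightarrow> 'a set \<Rightarrow> 'a set \<Rightarrow> real" where
  "incidence_matrix K d r f =
     (if r \<in> cells K (int d - 1) \<and> f \<in> cells K (int d) \<and>
         (\<exists>j\<le>d. r = f - {sorted_list_of_set f ! j})
      then (- 1) ^ (THE j. j \<le> d \<and> r = f - {sorted_list_of_set f ! j})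
      else 0)"

global_interpretation fun_space: vector_space "\<lambda>(c::real) (v::'b \<Rightarrow> real) x. c * v x"
  by unfold_locales (auto simp: fun_eq_iff algebra_simps)

definition incidence_column :: "'a::linorder set set \<Rightarrow> nat \<Rightarrow> 'a set \<Rightarrow> 'a set \<Rightarrow> real" where
  "incidence_column K d f = (\<lambda>r. incidence_matrix K d r f)"

definition incidence_row ::
  "'a::linorder set set \<Rightarrow> nat \<Rightarrow> 'a set set \<Rightarrow> 'a set \<Rightarrow> 'a set \<Rightarrow> real" where
  "incidence_row K d F r = (\<lambda>f. if f \<in> F then incidence_matrix K d r f else 0)"

text \<open>The injectivity conditions express independence of the indexed families of columns and
  rows: \<open>independent\<close> alone would not see repetitions.\<close>

definition rooted_forest ::
  "'a::linorder set set \<Rightarrow> nat \<Rightarrow> 'a set set \<Rightarrow> 'a set set \<Rightarrow> bool" where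
  "rooted_forest K d F R \<longleftrightarrow>
     F \<subseteq> cells K (int d) \<and> R \<subseteq> cells K (int d - 1) \<and>
     inj_on (incidence_column K d) F \<and>
     fun_space.independent (incidence_column K d ` F) \<and>
     (let R' = cells K (int d - 1) - R in
        inj_on (incidence_row K d F) R' \<and>
        fun_space.independent (incidence_row K d F ` R') \<and>
        fun_space.span (incidence_row K d F ` R') =
          fun_space.span (incidence_row K d F ` cells K (int d - 1)))"


section \<open>Simplicial collapse\<close>

definition elementary_collapse :: "nat \<Rightarrow> 'a set set \<Rightarrow> 'a set set \<Rightarrow> bool" where
  "elementary_collapse d L L' \<longleftrightarrow>
     (\<exists>\<sigma> \<tau>. \<sigma> \<in> L \<and> \<tau> \<in> L \<and> cell_dim \<tau> = int d \<and> codim1_face \<sigma> \<tau> \<and>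
        (\<forall>\<rho>\<in>L. \<sigma> \<subset> \<rho> \<longrightarrow> \<rho> = \<tau>) \<and> L' = L - {\<sigma>, \<tau>})"

definition simplicially_collapses ::
  "'a set set \<Rightarrow> nat \<Rightarrow> 'a set set \<Rightarrow> 'a set set \<Rightarrow> bool" where
  "simplicially_collapses K d F R \<longleftrightarrow>
     (elementary_collapse d)\<^sup>*\<^sup>* (skeleton K (int d - 1) \<union> F) (skeleton K (int d - 2) \<union> R)"


section \<open>Discrete Morse functions\<close>

text \<open>Functions are total on sets; only their values on \<open>K\<close> matter.\<close>

definition upper_faces :: "'a set set \<Rightarrow> ('a set \<Rightarrow> real) \<Rightarrow> 'a set \<Rightarrow> 'a set set" where
  "upper_faces K f \<sigma> = {\<tau> \<in> K. codim1_face \<tau> \<sigma> \<and> f \<tau> \<ge> f \<sigma>}"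

definition lower_cofaces :: "'a set set \<Rightarrow> ('a set \<Rightarrow> real) \<Rightarrow> 'a set \<Rightarrow> 'a set set" where
  "lower_cofaces K f \<sigma> = {\<tau> \<in> K. codim1_face \<sigma> \<tau> \<and> f \<tau> \<le> f \<sigma>}"

definition discrete_morse :: "'a set set \<Rightarrow> ('a set \<Rightarrow> real) \<Rightarrow> bool" where
  "discrete_morse K f \<longleftrightarrow>
     (\<forall>\<sigma>\<in>K. card (upper_faces K f \<sigma>) \<le> 1 \<and> card (lower_cofaces K f \<sigma>) \<le> 1)"

definition critical_cells :: "'a set set \<Rightarrow> ('a set \<Rightarrow> real) \<Rightarrow> int \<Rightarrow> 'a set set" where
  "critical_cells K f p =
     {\<sigma> \<in> cells K p. upper_faces K f \<sigma> = {} \<and> lower_cofaces K f \<sigma> = {}}"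

definition gradient :: "'a set set \<Rightarrow> ('a set \<Rightarrow> real) \<Rightarrow> ('a set \<times> 'a set) set" where
  "gradient K f = {(\<sigma>, \<tau>). \<sigma> \<in> K \<and> \<tau> \<in> K \<and> codim1_face \<sigma> \<tau> \<and> f \<tau> \<le> f \<sigma>}"

definition same_gradient :: "'a set set \<Rightarrow> (('a set \<Rightarrow> real) \<times> ('a set \<Rightarrow> real)) set" where
  "same_gradient K =
     {(f, g). discrete_morse K f \<and> discrete_morse K g \<and> gradient K f = gradient K g}"

definition morse_classes :: "'a set set \<Rightarrow> ('a set \<Rightarrow> real) set set" where
  "morse_classes K = {f. discrete_morse K f} // same_gradient K"

definition morse_level :: "'a set set \<Rightarrow> nat \<Rightarrow> nat \<Rightarrow> ('a set \<Rightarrow> real) set set" where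
  "morse_level K d l = {C \<in> morse_classes K. \<forall>f\<in>C.
     card (critical_cells K f (int d)) = l \<and>
     (\<forall>p < int d - 1. card (critical_cells K f p) = card (cells K p))}"

definition corresponds_to_gradient ::
  "'a set set \<Rightarrow> nat \<Rightarrow> 'a set set \<Rightarrow> 'a set set \<Rightarrow> bool" where
  "corresponds_to_gradient K d F R \<longleftrightarrow>
     (\<exists>l. \<exists>C \<in> morse_level K d l. \<exists>f\<in>C.
        F = cells K (int d) - critical_cells K f (int d) \<and>
        R = critical_cells K f (int d - 1))"

text \<open>Criticality depends only on the gradient, so the conditions imposed on a class above may be
  tested on any of its representatives.\<close>

lemma critical_cells_gradient:
  "critical_cells K f p =
     {\<sigma> \<in> cells K p. \<forall>\<tau>. (\<sigma>, \<tau>) \<notin> gradient K f \<and> (\<tau>, \<sigma>) \<notin> gradient K f}"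
  by (auto simp: critical_cells_def upper_faces_def lower_cofaces_def gradient_def cells_def)

lemma equiv_same_gradient: "equiv {f. discrete_morse K f} (same_gradient K)"
  by (auto simp: equiv_def refl_on_def sym_def trans_def same_gradient_def)

end

theory Submission
  imports Defs
begin

text \<open>If \<open>f\<close> realises \<open>(F, R)\<close>, its gradient matches each \<open>d\<close>-cell of \<open>F\<close> with one of its facets
  outside \<open>R\<close>. A cell of \<open>F\<close> on which \<open>f\<close> is maximal can be collapsed through its partner, since any
  other coface of the partner has a larger value; iterating removes all of \<open>F\<close>.
  Conversely, number the pairs of a collapsing sequence in reverse order of removal. This numbering,
  shifted above the dimensions of the lower cells and below a constant value on the \<open>d\<close>-cells
  outside \<open>F\<close>, is a discrete Morse function whose gradient consists of the collapsed pairs.\<close>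

section \<open>Cells and gradients of a finite complex\<close>

text \<open>\<open>has_dimension\<close> constrains maximal cells only; since the complex is finite,
  each cell lies in a maximal one.\<close>

lemma has_dimensionD:
  assumes "fin_complex K" "has_dimension K d" "\<sigma> \<in> K"
  shows "cell_dim \<sigma> \<le> int d"
proof -
  from assms obtain \<tau> where \<tau>: "\<tau> \<in> K" "\<sigma> \<subseteq> \<tau>" "\<forall>\<rho>\<in>K. \<tau> \<subseteq> \<rho> \<longrightarrow> \<rho> = \<tau>"
    using finite_has_maximal2[of K \<sigma>] by (auto simp: fin_complex_def)
  then have "cell_dim \<tau> \<le> int d" using assms(2) by (simp add: has_dimension_def)
  moreover have "card \<sigma> \<le> card \<tau>"
    using \<tau> assms(1) by (auto simp: fin_complex_def intro: card_mono)
  ultimately show ?thesis by (simp add: cell_dim_def)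
qed

lemma upper_faces_gradient: "\<tau> \<in> K \<Longrightarrow> upper_faces K f \<tau> = {\<sigma>. (\<sigma>, \<tau>) \<in> gradient K f}"
  by (auto simp: upper_faces_def gradient_def)

lemma lower_cofaces_gradient: "\<sigma> \<in> K \<Longrightarrow> lower_cofaces K f \<sigma> = {\<tau>. (\<sigma>, \<tau>) \<in> gradient K f}"
  by (auto simp: lower_cofaces_def gradient_def)

text \<open>In a finite complex the bounds on \<open>card\<close> really mean "at most one", so the
  gradient is the graph of an injective partial map.\<close>

lemma discrete_morse_gradient_unique:
  assumes "finite K" "discrete_morse K f"
  shows "(\<sigma>, \<tau>) \<in> gradient K f \<Longrightarrow> (\<sigma>', \<tau>) \<in> gradient K f \<Longrightarrow> \<sigma> = \<sigma>'"
    and "(\<sigma>, \<tau>) \<in> gradient K f \<Longrightarrow> (\<sigma>, \<tau>') \<in> gradient K f \<Longrightarrow> \<tau> = \<tau>'"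
proof -
  have fin: "finite (upper_faces K f x)" "finite (lower_cofaces K f x)" for x
    using assms(1) by (auto simp: upper_faces_def lower_cofaces_def)
  show "\<sigma> = \<sigma>'" if h: "(\<sigma>, \<tau>) \<in> gradient K f" "(\<sigma>', \<tau>) \<in> gradient K f"
  proof -
    have "\<tau> \<in> K" using h by (auto simp: gradient_def)
    moreover from this have "card (upper_faces K f \<tau>) \<le> Suc 0"
      using assms(2) by (simp add: discrete_morse_def)
    ultimately show ?thesis
      using h fin(1)[of \<tau>] by (simp add: upper_faces_gradient card_le_Suc0_iff_eq)
  qed
  show "\<tau> = \<tau>'" if h: "(\<sigma>, \<tau>) \<in> gradient K f" "(\<sigma>, \<tau>') \<in> gradient K f"
  proof -
    have "\<sigma> \<in> K" using h by (auto simp: gradient_def)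
    moreover from this have "card (lower_cofaces K f \<sigma>) \<le> Suc 0"
      using assms(2) by (simp add: discrete_morse_def)
    ultimately show ?thesis
      using h fin(2)[of \<sigma>] by (simp add: lower_cofaces_gradient card_le_Suc0_iff_eq)
  qed
qed

text \<open>Critical cells depend only on the gradient, so a class may be replaced by one
  representative. A subset of a finite set with the same cardinality is the whole set, and
  \<open>l\<close> is free to be the number of critical \<open>d\<close>-cells.\<close>

lemma corresponds_to_gradient_iff:
  assumes "finite K"
  shows "corresponds_to_gradient K d F R \<longleftrightarrow>
    (\<exists>f. discrete_morse K f \<and> (\<forall>p < int d - 1. critical_cells K f p = cells K p) \<and>
       F = cells K (int d) - critical_cells K f (int d) \<and> R = critical_cells K f (int d - 1))"
    (is "_ \<longleftrightarrow> ?rhs")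
proof
  have eq: "card (critical_cells K f p) = card (cells K p) \<longleftrightarrow> critical_cells K f p = cells K p"
    for f p
  proof -
    have "finite (cells K p)" "critical_cells K f p \<subseteq> cells K p"
      using assms by (auto simp: cells_def critical_cells_def)
    then show ?thesis by (metis card_subset_eq)
  qed
  {
    assume "corresponds_to_gradient K d F R"
    then obtain l C f where C: "C \<in> morse_level K d l" "f \<in> C"
      and FR: "F = cells K (int d) - critical_cells K f (int d)" "R = critical_cells K f (int d - 1)"
      by (auto simp: corresponds_to_gradient_def)
    have "C \<in> morse_classes K" using C by (auto simp: morse_level_def)
    then have "discrete_morse K f"
      using C(2) by (auto simp: morse_classes_def quotient_def same_gradient_def)
    moreover have "\<forall>p < int d - 1. critical_cells K f p = cells K p"
      using C by (auto simp: morse_level_def eq)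
    ultimately show ?rhs using FR by blast
  next
    assume ?rhs
    then obtain f where f: "discrete_morse K f"
      and low: "\<forall>p < int d - 1. critical_cells K f p = cells K p"
      and FR: "F = cells K (int d) - critical_cells K f (int d)" "R = critical_cells K f (int d - 1)"
      by auto
    define C where "C = same_gradient K `` {f}"
    have fC: "f \<in> C" using f by (simp add: C_def same_gradient_def)
    have "C \<in> morse_classes K"
      using f unfolding C_def morse_classes_def by (intro quotientI) simp
    moreover have "critical_cells K g p = critical_cells K f p" if "g \<in> C" for g p
      using that by (simp add: C_def same_gradient_def critical_cells_gradient)
    ultimately have "C \<in> morse_level K d (card (critical_cells K f (int d)))"
      using low by (simp add: morse_level_def)
    then show "corresponds_to_gradient K d F R"
      using fC FR unfolding corresponds_to_gradient_def by blast
  }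
qed

section \<open>From gradients to collapses\<close>

text \<open>The collapsing argument for an abstract matching \<open>m\<close>: \<open>f\<close>
  orders the removals and \<open>M\<close> is what survives. The recursion removes one pair at a
  time, and all assumptions pass to subsets of \<open>A\<close>.\<close>

lemma collapses_of_matching:
  fixes f :: "'a set \<Rightarrow> real"
  assumes "finite A" and "inj_on m A"
    and A: "\<And>\<tau>. \<tau> \<in> A \<Longrightarrow> cell_dim \<tau> = int d \<and> codim1_face (m \<tau>) \<tau> \<and> f \<tau> \<le> f (m \<tau>)"
    and other: "\<And>\<tau> \<tau>'. \<tau> \<in> A \<Longrightarrow> \<tau>' \<in> A \<Longrightarrow> m \<tau> \<subset> \<tau>' \<Longrightarrow> \<tau>' \<noteq> \<tau> \<Longrightarrow> f (m \<tau>) < f \<tau>'"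
    and M: "\<And>\<rho>. \<rho> \<in> M \<Longrightarrow> finite \<rho> \<and> cell_dim \<rho> < int d" "M \<inter> m ` A = {}"
  shows "(elementary_collapse d)\<^sup>*\<^sup>* (M \<union> m ` A \<union> A) M"
  using assms
proof (induction "card A" arbitrary: A)
  case 0
  then show ?case by simp
next
  case (Suc n)
  note A = Suc.prems(3) and other = Suc.prems(4) and M = Suc.prems(5,6)
  have "A \<noteq> {}" using Suc.hyps(2) by auto
  then have "Max (f ` A) \<in> f ` A" using Suc.prems(1) by simp
  then obtain \<tau> where \<tau>: "\<tau> \<in> A" and "Max (f ` A) = f \<tau>" by blast
  then have max: "f \<rho> \<le> f \<tau>" if "\<rho> \<in> A" for \<rho>
    using Max_ge[of "f ` A" "f \<rho>"] that Suc.prems(1) by simp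
  define B where "B = A - {\<tau>}"
  \<comment> \<open>\<open>card\<close> is 0 on infinite sets, which gives dimension -1; since
    \<open>d\<close> is nonnegative, a cell of dimension \<open>d\<close> is finite.\<close>
  have m_dim: "cell_dim (m \<rho>) = int d - 1" "finite \<rho>" if "\<rho> \<in> A" for \<rho>
    using A[OF that] by (auto simp: codim1_face_def cell_dim_def intro: card_ge_0_finite)
  have mA: "m \<rho> \<noteq> \<rho>'" if "\<rho> \<in> A" "\<rho>' \<in> A" for \<rho> \<rho>'
    using m_dim[OF that(1)] A[OF that(2)] by auto
  \<comment> \<open>Cells of \<open>M\<close> and partners under \<open>m\<close> are too small to
    contain \<open>m \<tau>\<close> strictly, so \<open>\<rho>\<close> lies in \<open>A\<close>.
    Were it not \<open>\<tau>\<close>, then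
    \<open>f (m \<tau>) < f \<rho> \<le> f \<tau> \<le> f (m \<tau>)\<close>.\<close>
  have free: "\<rho> = \<tau>" if "\<rho> \<in> M \<union> m ` A \<union> A" "m \<tau> \<subset> \<rho>" for \<rho>
  proof -
    have fin: "finite \<rho>"
      using that(1) M(1) m_dim(2) A unfolding codim1_face_def
      by (metis (no_types, lifting) UnE finite_subset imageE psubset_imp_subset)
    have "card (m \<tau>) < card \<rho>" using psubset_card_mono[OF fin that(2)] .
    then have "cell_dim \<rho> \<ge> int d" using m_dim(1)[OF \<tau>] by (simp add: cell_dim_def)
    then have "\<rho> \<in> A" using that(1) M(1) m_dim(1) by force
    then show ?thesis using other[OF \<tau> _ that(2)] max[of \<rho>] A[OF \<tau>] by force
  qed
  have "elementary_collapse d (M \<union> m ` A \<union> A) (M \<union> m ` B \<union> B)"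
    unfolding elementary_collapse_def
  proof (intro exI conjI)
    have "m ` B = m ` A - {m \<tau>}"
      using \<tau> Suc.prems(2) by (auto simp: B_def inj_on_def)
    moreover have "m \<tau> \<notin> M" "m \<tau> \<notin> A" "\<tau> \<notin> M" "\<tau> \<notin> m ` A"
      using \<tau> M mA A[OF \<tau>] by (auto dest: M(1))
    ultimately show "M \<union> m ` B \<union> B = (M \<union> m ` A \<union> A) - {m \<tau>, \<tau>}"
      unfolding B_def by blast
  qed (use \<tau> A free in auto)
  moreover have "(elementary_collapse d)\<^sup>*\<^sup>* (M \<union> m ` B \<union> B) M"
  proof (rule Suc.hyps(1))
    show "n = card B" using Suc.hyps(2) \<tau> Suc.prems(1) by (simp add: B_def)
    show "inj_on m B" using Suc.prems(2) by (auto simp: B_def inj_on_def)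
  qed (use Suc.prems in \<open>auto simp: B_def\<close>)
  ultimately show ?case by (rule converse_rtranclp_into_rtranclp)
qed

text \<open>Since all cells below dimension \<open>d - 1\<close> are critical, every gradient pair
  joins dimensions \<open>d - 1\<close> and \<open>d\<close>. The gradient is then a bijection
  between \<open>F\<close> and the \<open>(d-1)\<close>-cells outside \<open>R\<close>, to which the
  matching argument applies.\<close>

lemma collapses_of_corresponds:
  assumes K: "fin_complex K" "has_dimension K d"
    and corr: "corresponds_to_gradient K d F R"
  shows "simplicially_collapses K d F R"
proof -
  have finK: "finite K" using K by (simp add: fin_complex_def)
  obtain f where f: "discrete_morse K f"
    and low: "\<And>p. p < int d - 1 \<Longrightarrow> critical_cells K f p = cells K p"
    and F: "F = cells K (int d) - critical_cells K f (int d)"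
    and R: "R = critical_cells K f (int d - 1)"
    using corr unfolding corresponds_to_gradient_iff[OF finK] by auto
  note uniq = discrete_morse_gradient_unique[OF finK f]
  \<comment> \<open>The lower cell of a pair is not critical, which bounds its dimension from below;
    the dimension of \<open>K\<close> bounds the upper cell.\<close>
  have grad: "cell_dim \<tau> = int d \<and> cell_dim \<sigma> = int d - 1" if g: "(\<sigma>, \<tau>) \<in> gradient K f" for \<sigma> \<tau>
  proof -
    have *: "\<sigma> \<in> K" "\<tau> \<in> K" "cell_dim \<tau> = cell_dim \<sigma> + 1"
      using g by (auto simp: gradient_def codim1_face_def)
    have "\<sigma> \<notin> critical_cells K f (cell_dim \<sigma>)" using g by (auto simp: critical_cells_gradient)
    moreover have "\<sigma> \<in> cells K (cell_dim \<sigma>)" using * by (simp add: cells_def)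
    ultimately have "\<not> cell_dim \<sigma> < int d - 1" using low by blast
    then show ?thesis using * has_dimensionD[OF K, of \<tau>] by simp
  qed
  \<comment> \<open>By \<open>grad\<close>, a non-critical \<open>d\<close>-cell can only be the
    upper member of a pair; dually, in \<open>R_iff\<close>, a non-critical
    \<open>(d-1)\<close>-cell can only be the lower one.\<close>
  have F_iff: "\<tau> \<in> F \<longleftrightarrow> (\<exists>\<sigma>. (\<sigma>, \<tau>) \<in> gradient K f)" for \<tau>
  proof
    assume "\<tau> \<in> F"
    then show "\<exists>\<sigma>. (\<sigma>, \<tau>) \<in> gradient K f"
      by (auto simp: F critical_cells_gradient cells_def dest: grad)
  next
    assume "\<exists>\<sigma>. (\<sigma>, \<tau>) \<in> gradient K f"
    then obtain \<sigma> where g: "(\<sigma>, \<tau>) \<in> gradient K f" ..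
    then have "\<tau> \<in> cells K (int d)" using grad[OF g] by (auto simp: cells_def gradient_def)
    then show "\<tau> \<in> F" using g by (auto simp: F critical_cells_gradient)
  qed
  have R_iff: "\<sigma> \<in> cells K (int d - 1) - R \<longleftrightarrow> (\<exists>\<tau>. (\<sigma>, \<tau>) \<in> gradient K f)" for \<sigma>
  proof
    assume "\<sigma> \<in> cells K (int d - 1) - R"
    then show "\<exists>\<tau>. (\<sigma>, \<tau>) \<in> gradient K f"
      by (auto simp: R critical_cells_gradient cells_def dest: grad)
  next
    assume "\<exists>\<tau>. (\<sigma>, \<tau>) \<in> gradient K f"
    then obtain \<tau> where g: "(\<sigma>, \<tau>) \<in> gradient K f" ..
    then have "\<sigma> \<in> cells K (int d - 1)" using grad[OF g] by (auto simp: cells_def gradient_def)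
    then show "\<sigma> \<in> cells K (int d - 1) - R" using g by (auto simp: R critical_cells_gradient)
  qed
  define m where "m \<tau> = (SOME \<sigma>. (\<sigma>, \<tau>) \<in> gradient K f)" for \<tau>
  have m: "(m \<tau>, \<tau>) \<in> gradient K f" if "\<tau> \<in> F" for \<tau>
    using that unfolding F_iff m_def by (rule someI_ex)
  define M where "M = skeleton K (int d - 2) \<union> R"
  have mF: "m ` F = cells K (int d - 1) - R"
  proof (intro equalityI subsetI)
    fix \<sigma> assume "\<sigma> \<in> cells K (int d - 1) - R"
    then obtain \<tau> where g: "(\<sigma>, \<tau>) \<in> gradient K f" using R_iff by blast
    then have "\<tau> \<in> F" using F_iff by blast
    \<comment> \<open>Uniqueness of the lower partner identifies \<open>\<sigma>\<close> with the
      chosen \<open>m \<tau>\<close>.\<close>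
    then show "\<sigma> \<in> m ` F" using uniq(1)[OF g m] by auto
  qed (use m R_iff in blast)
  have "(elementary_collapse d)\<^sup>*\<^sup>* (M \<union> m ` F \<union> F) M"
  proof (rule collapses_of_matching)
    show "finite F" using finK by (auto simp: F cells_def)
    show "inj_on m F" using m uniq(2) by (metis inj_onI)
    show "cell_dim \<tau> = int d \<and> codim1_face (m \<tau>) \<tau> \<and> f \<tau> \<le> f (m \<tau>)" if "\<tau> \<in> F" for \<tau>
      using m[OF that] grad[OF m[OF that]] by (simp add: gradient_def)
    show "f (m \<tau>) < f \<tau>'" if "\<tau> \<in> F" "\<tau>' \<in> F" "m \<tau> \<subset> \<tau>'" "\<tau>' \<noteq> \<tau>" for \<tau> \<tau>'
    proof (rule ccontr)
      assume "\<not> f (m \<tau>) < f \<tau>'"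
      \<comment> \<open>The dimensions turn the strict inclusion into codimension one, so
        \<open>m \<tau>\<close> would have two partners.\<close>
      then have "(m \<tau>, \<tau>') \<in> gradient K f"
        using m[OF that(1)] m[OF that(2)] grad[OF m[OF that(1)]] grad[OF m[OF that(2)]] that(3)
        by (auto simp: gradient_def codim1_face_def)
      then show False using uniq(2) m that by blast
    qed
    show "finite \<rho> \<and> cell_dim \<rho> < int d" if "\<rho> \<in> M" for \<rho>
      using that K(1) by (auto simp: M_def R fin_complex_def critical_cells_def cells_def skeleton_def)
    show "M \<inter> m ` F = {}" unfolding mF by (auto simp: M_def cells_def skeleton_def)
  qed
  moreover have "M \<union> m ` F \<union> F = skeleton K (int d - 1) \<union> F"
    unfolding mF by (auto simp: M_def R critical_cells_def skeleton_def cells_def)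
  ultimately show ?thesis by (simp add: simplicially_collapses_def M_def)
qed

section \<open>From collapses to gradients\<close>

text \<open>\<open>D\<close> stands for the set of removed cells. Each singleton records two facts:
  existence makes \<open>x\<close> non-critical, and uniqueness is the Morse condition on that
  side.\<close>

definition collapse_order :: "nat \<Rightarrow> 'a set set \<Rightarrow> ('a set \<Rightarrow> nat) \<Rightarrow> bool" where
  "collapse_order d D g \<longleftrightarrow> (\<forall>x\<in>D.
     cell_dim x = int d - 1 \<and> (\<exists>\<tau>. {\<tau>\<in>D. codim1_face x \<tau> \<and> g \<tau> \<le> g x} = {\<tau>}) \<or>
     cell_dim x = int d \<and> (\<exists>\<sigma>. {\<sigma>\<in>D. codim1_face \<sigma> x \<and> g x \<le> g \<sigma>} = {\<sigma>}))"

text \<open>The induction prepends a collapse, so the pair removed first is numbered last and gets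
  the largest value. The bound \<open>b\<close> is carried along to make such a value
  available.\<close>

lemma collapse_order_exists:
  assumes "(elementary_collapse d)\<^sup>*\<^sup>* L M"
  shows "M \<subseteq> L \<and> (\<exists>g b. (\<forall>x. g x \<le> b) \<and> collapse_order d (L - M) g)"
  using assms
proof (induction rule: converse_rtranclp_induct)
  case base
  then show ?case by (auto simp: collapse_order_def)
next
  case (step L L')
  from step.IH obtain g b where "M \<subseteq> L'" and b: "\<And>x. g x \<le> b"
    and ord: "collapse_order d (L' - M) g"
    by blast
  note g = ord[unfolded collapse_order_def, rule_format]
  from step.hyps(1) obtain \<sigma> \<tau> where st: "\<sigma> \<in> L" "\<tau> \<in> L" "cell_dim \<tau> = int d" "codim1_face \<sigma> \<tau>"
    and free: "\<And>\<rho>. \<rho> \<in> L \<Longrightarrow> \<sigma> \<subset> \<rho> \<Longrightarrow> \<rho> = \<tau>" and L': "L' = L - {\<sigma>, \<tau>}"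
    by (auto simp: elementary_collapse_def)
  have \<sigma>_dim: "cell_dim \<sigma> = int d - 1" using st by (simp add: codim1_face_def)
  have D: "L - M = insert \<sigma> (insert \<tau> (L' - M))" using st L' \<open>M \<subseteq> L'\<close> by auto
  have dims: "cell_dim x = int d - 1 \<or> cell_dim x = int d" if "x \<in> L' - M" for x
    using g[OF that] by blast
  \<comment> \<open>Equal values on \<open>\<sigma>\<close> and \<open>\<tau>\<close> satisfy the
    weak inequality that pairs them.\<close>
  define h where "h = g(\<sigma> := Suc b, \<tau> := Suc b)"
  have h: "h \<sigma> = Suc b" "h \<tau> = Suc b" by (auto simp: h_def)
  have hg: "h x = g x" if "x \<in> L' - M" for x using that L' by (auto simp: h_def)
  have hb: "\<not> Suc b \<le> h x" if "x \<in> L' - M" for x using hg[OF that] b[of x] by simp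
  have not_coface: "\<not> codim1_face \<sigma> x" if "x \<in> L' - M" for x
    using that free[of x] L' by (auto simp: codim1_face_def)
  have irrefl: "\<not> codim1_face x x" for x :: "'a set" by (simp add: codim1_face_def)
  have "collapse_order d (L - M) h"
    unfolding collapse_order_def
  proof
    fix x assume "x \<in> L - M"
    then consider "x = \<sigma>" | "x = \<tau>" | "x \<in> L' - M" using D by blast
    then show "cell_dim x = int d - 1 \<and> (\<exists>\<tau>. {\<tau>\<in>L - M. codim1_face x \<tau> \<and> h \<tau> \<le> h x} = {\<tau>}) \<or>
      cell_dim x = int d \<and> (\<exists>\<sigma>. {\<sigma>\<in>L - M. codim1_face \<sigma> x \<and> h x \<le> h \<sigma>} = {\<sigma>})" (is ?goal)
    proof cases
      case 1
      have "{\<tau>\<in>L - M. codim1_face \<sigma> \<tau> \<and> h \<tau> \<le> h \<sigma>} = {\<tau>}"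
        unfolding D using st not_coface irrefl h by auto
      then show ?goal using 1 \<sigma>_dim by blast
    next
      case 2
      \<comment> \<open>Other facets of \<open>\<tau>\<close> in \<open>L - M\<close> have values at
        most \<open>b\<close>.\<close>
      have "{\<sigma>\<in>L - M. codim1_face \<sigma> \<tau> \<and> h \<tau> \<le> h \<sigma>} = {\<sigma>}"
        unfolding D using st irrefl h hb by auto
      then show ?goal using 2 st(3) by blast
    next
      case 3
      from g[OF 3] show ?goal
      proof (elim disjE conjE exE)
        fix \<tau>' assume d: "cell_dim x = int d - 1"
          and s: "{\<tau>\<in>L' - M. codim1_face x \<tau> \<and> g \<tau> \<le> g x} = {\<tau>'}"
        \<comment> \<open>The new cell \<open>\<tau>\<close> may be a coface of \<open>x\<close>,
          but its value is too large for it to be paired with \<open>x\<close>.\<close>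
        have "\<not> codim1_face x \<sigma>" using d \<sigma>_dim by (simp add: codim1_face_def)
        then have "{\<tau>\<in>L - M. codim1_face x \<tau> \<and> h \<tau> \<le> h x} =
            {\<tau>\<in>L' - M. codim1_face x \<tau> \<and> g \<tau> \<le> g x}"
          unfolding D using h hb[OF 3] hg[OF 3] by (auto simp: hg)
        then show ?goal using d s by auto
      next
        fix \<sigma>' assume d: "cell_dim x = int d"
          and s: "{\<sigma>\<in>L' - M. codim1_face \<sigma> x \<and> g x \<le> g \<sigma>} = {\<sigma>'}"
        \<comment> \<open>Here the large value of \<open>\<sigma>\<close> would create a second
          partner if \<open>\<sigma>\<close> were a face of \<open>x\<close>; freeness, in the form
          \<open>not_coface\<close>, excludes this.\<close>
        have "\<not> codim1_face \<tau> x" using d st(3) by (simp add: codim1_face_def)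
        then have "{\<sigma>\<in>L - M. codim1_face \<sigma> x \<and> h x \<le> h \<sigma>} =
            {\<sigma>\<in>L' - M. codim1_face \<sigma> x \<and> g x \<le> g \<sigma>}"
          unfolding D using not_coface[OF 3] hg[OF 3] by (auto simp: hg)
        then show ?goal using d s by auto
      qed
    qed
  qed
  moreover have "\<forall>x. h x \<le> Suc b" using b by (auto simp: h_def le_Suc_eq)
  moreover have "M \<subseteq> L" using \<open>M \<subseteq> L'\<close> L' by blast
  ultimately show ?case by blast
qed

text \<open>A collapse order on the removed cells is extended to all of \<open>K\<close> so that no
  gradient pair involves a surviving cell.\<close>

lemma corresponds_of_collapses:
  assumes K: "fin_complex K" "has_dimension K d"
    and F: "F \<subseteq> cells K (int d)" and R: "R \<subseteq> cells K (int d - 1)"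
    and coll: "simplicially_collapses K d F R"
  shows "corresponds_to_gradient K d F R"
proof -
  have finK: "finite K" using K by (simp add: fin_complex_def)
  define D where "D = (skeleton K (int d - 1) \<union> F) - (skeleton K (int d - 2) \<union> R)"
  have FR: "F \<inter> R = {}" using F R by (force simp: cells_def)
  then have D: "D = F \<union> (cells K (int d - 1) - R)"
    using F R by (auto simp: D_def skeleton_def cells_def)
  obtain g b where b: "\<And>x. g x \<le> b" and ord: "collapse_order d D g"
    using collapse_order_exists[OF coll[unfolded simplicially_collapses_def]]
    unfolding D_def by blast
  note g = ord[unfolded collapse_order_def, rule_format]
  have DK: "D \<subseteq> K" using F by (auto simp: D cells_def)
  have Ddim: "cell_dim x = int d - 1 \<or> cell_dim x = int d" if "x \<in> D" for x
    using g[OF that] by blast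
  \<comment> \<open>Three levels: surviving cells below dimension \<open>d\<close> have values at
    most \<open>d - 1\<close>, removed cells lie between \<open>d\<close> and \<open>d + b\<close>,
    and surviving \<open>d\<close>-cells at \<open>d + b + 1\<close>.\<close>
  define f :: "'a set \<Rightarrow> real" where "f x = (if x \<in> D then real d + real (g x)
    else if cell_dim x = int d then real d + real b + 1 else of_int (cell_dim x))" for x
  have grad: "gradient K f = {(\<sigma>, \<tau>). \<sigma> \<in> D \<and> \<tau> \<in> D \<and> codim1_face \<sigma> \<tau> \<and> g \<tau> \<le> g \<sigma>}"
  proof (intro equalityI subsetI)
    fix p assume "p \<in> gradient K f"
    then obtain \<sigma> \<tau> where p: "p = (\<sigma>, \<tau>)" "\<sigma> \<in> K" "\<tau> \<in> K" "codim1_face \<sigma> \<tau>" "f \<tau> \<le> f \<sigma>"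
      by (auto simp: gradient_def)
    have dim: "cell_dim \<tau> = cell_dim \<sigma> + 1" using p by (simp add: codim1_face_def)
    have le: "cell_dim \<tau> \<le> int d" using has_dimensionD[OF K] p by blast
    have rle: "real_of_int (cell_dim \<sigma>) + 1 \<le> real d" using le dim by linarith
    have "\<tau> \<in> D"
    proof (rule ccontr)
      assume n: "\<tau> \<notin> D"
      show False
      proof (cases "cell_dim \<tau> = int d")
        case True
        then show False using p(5) n dim rle b[of \<sigma>] by (auto simp: f_def split: if_splits)
      next
        case False
        \<comment> \<open>The dimension of \<open>\<sigma>\<close> is now below
          \<open>d - 1\<close>, so on both cells \<open>f\<close> is the dimension, which strictly
          increases from \<open>\<sigma>\<close> to \<open>\<tau>\<close>.\<close>
        then have "\<sigma> \<notin> D" using Ddim[of \<sigma>] dim le by auto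
        then show False using p(5) n False dim le by (auto simp: f_def)
      qed
    qed
    \<comment> \<open>As a proper face, \<open>\<sigma>\<close> outside \<open>D\<close> would have
      value at most \<open>d - 1\<close>, below the least value \<open>d\<close> on
      \<open>D\<close>.\<close>
    moreover have "\<sigma> \<in> D"
      using p(5) \<open>\<tau> \<in> D\<close> dim le rle by (auto simp: f_def split: if_splits)
    ultimately show "p \<in> {(\<sigma>, \<tau>). \<sigma> \<in> D \<and> \<tau> \<in> D \<and> codim1_face \<sigma> \<tau> \<and> g \<tau> \<le> g \<sigma>}"
      using p by (simp add: f_def)
  qed (use DK in \<open>auto simp: gradient_def f_def\<close>)
  \<comment> \<open>The singletons of \<open>collapse_order\<close> give every cell of
    \<open>D\<close> a partner, and by \<open>grad\<close> no other cell has one.\<close>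
  have crit: "critical_cells K f p = cells K p - D" for p
  proof -
    have "\<exists>\<tau>. (x, \<tau>) \<in> gradient K f \<or> (\<tau>, x) \<in> gradient K f" if "x \<in> D" for x
      using g[OF that] that unfolding grad by blast
    moreover have "(x, \<tau>) \<notin> gradient K f \<and> (\<tau>, x) \<notin> gradient K f" if "x \<notin> D" for x \<tau>
      using that unfolding grad by blast
    ultimately show ?thesis unfolding critical_cells_gradient by blast
  qed
  have "discrete_morse K f"
    unfolding discrete_morse_def
  proof (intro ballI conjI)
    fix x assume x: "x \<in> K"
    have up: "upper_faces K f x = (if x \<in> D then {\<sigma>\<in>D. codim1_face \<sigma> x \<and> g x \<le> g \<sigma>} else {})"
      using x by (auto simp: upper_faces_gradient grad)
    have lo: "lower_cofaces K f x = (if x \<in> D then {\<tau>\<in>D. codim1_face x \<tau> \<and> g \<tau> \<le> g x} else {})"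
      using x by (auto simp: lower_cofaces_gradient grad)
    \<comment> \<open>These two facts settle the side on which \<open>collapse_order\<close> is
      silent: \<open>D\<close> contains no cells of dimension \<open>d - 2\<close> or
      \<open>d + 1\<close>.\<close>
    have no_up: "{\<sigma>\<in>D. codim1_face \<sigma> x \<and> g x \<le> g \<sigma>} = {}" if "cell_dim x = int d - 1"
      using that Ddim by (fastforce simp: codim1_face_def)
    have no_lo: "{\<tau>\<in>D. codim1_face x \<tau> \<and> g \<tau> \<le> g x} = {}" if "cell_dim x = int d"
      using that Ddim by (fastforce simp: codim1_face_def)
    show "card (upper_faces K f x) \<le> 1"
    proof (cases "x \<in> D")
      case True
      from g[OF True] consider "cell_dim x = int d - 1" | y where "{\<sigma>\<in>D. codim1_face \<sigma> x \<and> g x \<le> g \<sigma>} = {y}"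
        by blast
      then show ?thesis
      proof cases
        case 1
        show ?thesis unfolding up no_up[OF 1] by simp
      next
        case 2
        show ?thesis unfolding up 2 by simp
      qed
    qed (simp add: up)
    show "card (lower_cofaces K f x) \<le> 1"
    proof (cases "x \<in> D")
      case True
      from g[OF True] consider "cell_dim x = int d" | y where "{\<tau>\<in>D. codim1_face x \<tau> \<and> g \<tau> \<le> g x} = {y}"
        by blast
      then show ?thesis
      proof cases
        case 1
        show ?thesis unfolding lo no_lo[OF 1] by simp
      next
        case 2
        show ?thesis unfolding lo 2 by simp
      qed
    qed (simp add: lo)
  qed
  moreover have "critical_cells K f p = cells K p" if "p < int d - 1" for p
    unfolding crit using that Ddim by (fastforce simp: cells_def)
  moreover have "F = cells K (int d) - critical_cells K f (int d)"
    unfolding crit using F by (auto simp: D cells_def)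
  moreover have "R = critical_cells K f (int d - 1)"
    unfolding crit using F R FR by (auto simp: D cells_def)
  ultimately show ?thesis unfolding corresponds_to_gradient_iff[OF finK] by blast
qed

theorem theorem4p2:
  fixes K :: "'a::linorder set set" and d :: nat and F R :: "'a set set"
  assumes "fin_complex K" and "has_dimension K d" and "rooted_forest K d F R"
  shows "corresponds_to_gradient K d F R \<longleftrightarrow> simplicially_collapses K d F R"
proof -
  have "F \<subseteq> cells K (int d)" "R \<subseteq> cells K (int d - 1)"
    using assms(3) by (simp_all add: rooted_forest_def)
  then show ?thesis
    using collapses_of_corresponds corresponds_of_collapses assms(1,2) by blast
qed

end
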